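(* Let $\beta$ be one of the $*$-patterns $12*$, $1{*}3$, $*23$. Under $123\leftrightarrow\beta$, for each permutation $\tau$ avoiding $123$, there exists a distinct equivalence class consisting of all permutations $\pi$ whose primitive permutation under $123 \leftrightarrow \beta$ is $\tau$.
   Context: A permutation of length $n\ge 0$ is a string consisting of the integers $1,\dots,n$, each occurring exactly once. Substrings are not required to be contiguous. A permutation avoids $123$ if it has no increasing (not necessarily contiguous) substring of length $3$. $*$-patterns. For strings $\rho,\delta$ of distinct positive integers and symbols $*$ (several $*$'s are allowed), a (not necessarily contiguous) substring $r$ of $\rho$ is a copy of $\delta$ if $r$ and $\delta$ have $*$'s in the same positions and, ignoring all $*$'s, are order-isomorphic. Replacement. Let $\alpha,\beta$ be $*$-patterns of equal length. A permutation $\sigma$ is a result of the replacement $\alpha\to\beta$ on a permutation $\pi$ if it can be obtained as follows. (1) Renumber the integers of $\pi$ as necessary by positive integers, preserving relative order, and insert any number of $*$'s anywhere; call the result $\rho^{(1)}$. (2) Choose a substring $a$ of $\rho^{(1)}$ that is a copy of $\alpha$, and a string $b$ of distinct positive integers and $*$'s such that: $b$ is a copy of $\beta$; all (integer) elements common to $b$ and $\rho^{(1)}$ are contained in $a$; and for every integer $x$ occurring in both $\alpha$ and $\beta$, if $y$ is the integer in $a$ at the same position as $x$ in $\alpha$, then $y$ is in $b$ at the same position as $x$ in $\beta$. Replace $a$ by $b$ in $\rho^{(1)}$ (position by position). (3) Delete all $*$'s and renumber, preserving relative order, to get the permutation $\sigma$. Elements involved need not be adjacent in position or value, and the length may change.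 Equivalence. Two permutations (possibly of different lengths) are equivalent under $\alpha\leftrightarrow\beta$ if one can be obtained from the other by a finite (possibly empty) sequence of $\alpha\to\beta$ and $\beta\to\alpha$ replacements. This partitions the set of all permutations $S_0\cup S_1\cup S_2\cup\cdots$ into equivalence classes. Primitive permutation. The primitive permutation of $\pi$ under $123\leftrightarrow\beta$ is the unique permutation of shortest length equivalent to $\pi$, if it exists. For the three $\beta$ considered here it is the result of repeatedly applying to $\pi$ the replacement $123\to\beta$ on any choice of a copy of $123$ until none exist. *)

theory Defs
  imports "HOL-Combinatorics.Multiset_Permutations" "HOL-Library.Sublist"
begin

definition perms :: "nat list set" where
  "perms = (\<Union>n. permutations_of_set {1..n})"

definition avoids_123 :: "nat list \<Rightarrow> bool" where
  "avoids_123 \<pi> \<longleftrightarrow> \<not> (\<exists>r. subseq r \<pi> \<and> length r = 3 \<and> sorted_wrt (<) r)"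

text \<open>Strings that may contain the symbol \<open>*\<close> are lists over \<^typ>\<open>nat option\<close>,
  where \<^const>\<open>None\<close> stands for \<open>*\<close>.\<close>

definition ints :: "nat option list \<Rightarrow> nat list" where
  "ints s = List.map_filter (\<lambda>x. x) s"

definition star_string :: "nat option list \<Rightarrow> bool" where
  "star_string s \<longleftrightarrow> distinct (ints s) \<and> (\<forall>x\<in>set (ints s). 0 < x)"

definition order_iso :: "nat list \<Rightarrow> nat list \<Rightarrow> bool" where
  "order_iso xs ys \<longleftrightarrow> length xs = length ys \<and>
     (\<forall>i<length xs. \<forall>j<length xs. xs ! i < xs ! j \<longleftrightarrow> ys ! i < ys ! j)"

definition is_copy :: "nat option list \<Rightarrow> nat option list \<Rightarrow> bool" where
  "is_copy r \<delta> \<longleftrightarrow> length r = length \<delta> \<and>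
     (\<forall>i<length r. r ! i = None \<longleftrightarrow> \<delta> ! i = None) \<and> order_iso (ints r) (ints \<delta>)"

text \<open>A result \<open>\<sigma>\<close> of the replacement \<open>\<alpha> \<rightarrow> \<beta>\<close> on \<open>\<pi>\<close>.  The list \<open>\<rho>\<^sub>1\<close> is \<open>\<pi>\<close> renumbered and with
  \<open>*\<close>'s inserted; \<open>ps\<close> lists the positions of the chosen substring \<open>a\<close> of \<open>\<rho>\<^sub>1\<close>; and \<open>\<rho>\<^sub>2\<close> is \<open>\<rho>\<^sub>1\<close>
  with \<open>b\<close> written over \<open>a\<close> at these positions.\<close>

definition replacement ::
  "nat option list \<Rightarrow> nat option list \<Rightarrow> nat list \<Rightarrow> nat list \<Rightarrow> bool" where
  "replacement \<alpha> \<beta> \<pi> \<sigma> \<longleftrightarrow> \<pi> \<in> perms \<and> \<sigma> \<in> perms \<and>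
     (\<exists>\<rho>\<^sub>1 \<rho>\<^sub>2 ps a b.
        star_string \<rho>\<^sub>1 \<and> order_iso (ints \<rho>\<^sub>1) \<pi> \<and>
        sorted_wrt (<) ps \<and> set ps \<subseteq> {..<length \<rho>\<^sub>1} \<and> a = map ((!) \<rho>\<^sub>1) ps \<and> is_copy a \<alpha> \<and>
        star_string b \<and> is_copy b \<beta> \<and>
        set (ints b) \<inter> set (ints \<rho>\<^sub>1) \<subseteq> set (ints a) \<and>
        (\<forall>i<length \<alpha>. \<forall>j<length \<beta>. \<alpha> ! i = \<beta> ! j \<and> \<alpha> ! i \<noteq> None \<longrightarrow> a ! i = b ! j) \<and>
        length \<rho>\<^sub>2 = length \<rho>\<^sub>1 \<and> map ((!) \<rho>\<^sub>2) ps = b \<and>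
        (\<forall>i<length \<rho>\<^sub>1. i \<notin> set ps \<longrightarrow> \<rho>\<^sub>2 ! i = \<rho>\<^sub>1 ! i) \<and>
        order_iso (ints \<rho>\<^sub>2) \<sigma>)"

definition equiv_rel :: "nat option list \<Rightarrow> nat option list \<Rightarrow> (nat list \<times> nat list) set" where
  "equiv_rel \<alpha> \<beta> = {(\<pi>, \<sigma>). \<pi> \<in> perms \<and> \<sigma> \<in> perms \<and>
     (\<lambda>x y. replacement \<alpha> \<beta> x y \<or> replacement \<beta> \<alpha> x y)\<^sup>*\<^sup>* \<pi> \<sigma>}"

text \<open>\<open>\<tau>\<close> is the unique shortest permutation equivalent to \<open>\<pi>\<close>.\<close>

definition is_primitive ::
  "nat option list \<Rightarrow> nat option list \<Rightarrow> nat list \<Rightarrow> nat list \<Rightarrow> bool" where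
  "is_primitive \<alpha> \<beta> \<pi> \<tau> \<longleftrightarrow>
     is_arg_min length (\<lambda>\<sigma>. (\<pi>, \<sigma>) \<in> equiv_rel \<alpha> \<beta>) \<tau> \<and>
     (\<forall>\<tau>'. is_arg_min length (\<lambda>\<sigma>. (\<pi>, \<sigma>) \<in> equiv_rel \<alpha> \<beta>) \<tau>' \<longrightarrow> \<tau>' = \<tau>)"

definition primitive_class ::
  "nat option list \<Rightarrow> nat option list \<Rightarrow> nat list \<Rightarrow> nat list set" where
  "primitive_class \<alpha> \<beta> \<tau> = {\<pi> \<in> perms. is_primitive \<alpha> \<beta> \<pi> \<tau>}"

definition p123 :: "nat option list" where "p123 = [Some 1, Some 2, Some 3]"

lemma set_ints: "x \<in> set (ints s) \<longleftrightarrow> Some x \<in> set s"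
  by (induction s) (auto simp: ints_def split: option.splits)

lemma mem_ints: "x \<in> set (ints s) \<longleftrightarrow> (\<exists>i<length s. s ! i = Some x)"
  unfolding set_ints by (auto simp: in_set_conv_nth)

lemma distinct_ints:
  "distinct (ints s) \<longleftrightarrow> (\<forall>i<length s. \<forall>j<length s. i \<noteq> j \<longrightarrow> s ! i \<noteq> None \<longrightarrow> s ! i \<noteq> s ! j)"
proof (induction s)
  case (Cons c s)
  have "distinct (ints (c # s)) \<longleftrightarrow> (c \<noteq> None \<longrightarrow> c \<notin> set s) \<and> distinct (ints s)"
    by (cases c) (auto simp: ints_def set_ints[unfolded ints_def])
  also have "\<dots> \<longleftrightarrow> (\<forall>j<length s. c \<noteq> None \<longrightarrow> c \<noteq> s ! j) \<and> distinct (ints s)"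
    by (auto simp: in_set_conv_nth)
  finally show ?case
  proof -
    have "(\<forall>i<Suc n. \<forall>j<Suc n. i \<noteq> j \<longrightarrow> Q i j) \<longleftrightarrow>
        (\<forall>j<n. Q 0 (Suc j)) \<and> (\<forall>i<n. Q (Suc i) 0) \<and> (\<forall>i<n. \<forall>j<n. i \<noteq> j \<longrightarrow> Q (Suc i) (Suc j))"
      for n and Q :: "nat \<Rightarrow> nat \<Rightarrow> bool"
      by (simp add: All_less_Suc2) blast
    note * = this[of "length s" "\<lambda>i j. (c # s) ! i \<noteq> None \<longrightarrow> (c # s) ! i \<noteq> (c # s) ! j"]
    assume "distinct (ints (c # s)) \<longleftrightarrow> (\<forall>j<length s. c \<noteq> None \<longrightarrow> c \<noteq> s ! j) \<and> distinct (ints s)"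
    moreover have "(\<forall>i<length s. s ! i \<noteq> None \<longrightarrow> s ! i \<noteq> c) \<longleftrightarrow> (\<forall>j<length s. c \<noteq> None \<longrightarrow> c \<noteq> s ! j)"
      by metis
    ultimately show ?case
      unfolding length_Cons * nth_Cons_0 nth_Cons_Suc Cons.IH by argo
  qed
qed (simp add: ints_def)

lemma perms_distinct: "\<pi> \<in> perms \<Longrightarrow> distinct \<pi>"
  by (auto simp: perms_def permutations_of_set_def)

lemma replacement_sym:
  assumes "replacement \<alpha> \<beta> \<pi> \<sigma>" shows "replacement \<beta> \<alpha> \<sigma> \<pi>"
proof -
  obtain \<rho>1 \<rho>2 ps a b where P: "\<pi> \<in> perms" "\<sigma> \<in> perms"
    and h: "star_string \<rho>1" "order_iso (ints \<rho>1) \<pi>"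
        "sorted_wrt (<) ps" "set ps \<subseteq> {..<length \<rho>1}" "a = map ((!) \<rho>1) ps" "is_copy a \<alpha>"
        "star_string b" "is_copy b \<beta>"
        "set (ints b) \<inter> set (ints \<rho>1) \<subseteq> set (ints a)"
        "\<forall>i<length \<alpha>. \<forall>j<length \<beta>. \<alpha> ! i = \<beta> ! j \<and> \<alpha> ! i \<noteq> None \<longrightarrow> a ! i = b ! j"
        "length \<rho>2 = length \<rho>1" "map ((!) \<rho>2) ps = b"
        "\<forall>i<length \<rho>1. i \<notin> set ps \<longrightarrow> \<rho>2 ! i = \<rho>1 ! i"
        "order_iso (ints \<rho>2) \<sigma>"
    using assms unfolding replacement_def by (elim conjE exE) (rule that)
  have dps: "distinct ps" using h(3) by (simp add: strict_sorted_iff)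
  have d1: "distinct (ints \<rho>1)" using h(1) by (simp add: star_string_def)
  have bps: "x \<in> set (ints b) \<longleftrightarrow> (\<exists>p\<in>set ps. \<rho>2 ! p = Some x)" for x
    unfolding set_ints h(12)[symmetric] by (auto simp: image_iff eq_commute)
  have aps: "x \<in> set (ints a) \<longleftrightarrow> (\<exists>p\<in>set ps. \<rho>1 ! p = Some x)" for x
    unfolding set_ints h(5) by (auto simp: image_iff eq_commute)
  have r2: "x \<in> set (ints b) \<or> (\<exists>i<length \<rho>1. i \<notin> set ps \<and> \<rho>1 ! i = Some x)"
    if "x \<in> set (ints \<rho>2)" for x
    using that h(11,13) unfolding bps by (metis mem_ints)
  have "distinct (ints \<rho>2)"
    using h(14) perms_distinct[OF P(2)] unfolding order_iso_def distinct_conv_nth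
    by (metis less_irrefl linorder_neqE_nat)
  moreover have "0 < x" if "x \<in> set (ints \<rho>2)" for x
    using r2[OF that] h(1,7) by (auto simp: star_string_def mem_ints)
  ultimately have s2: "star_string \<rho>2" by (simp add: star_string_def)
  have da: "distinct (ints a)"
    unfolding distinct_ints
  proof (intro allI impI)
    fix i j assume ij: "i < length a" "j < length a" "i \<noteq> j" "a ! i \<noteq> None"
    then have "ps ! i \<noteq> ps ! j" "ps ! i < length \<rho>1" "ps ! j < length \<rho>1"
      using h(4,5) dps nth_mem by (auto simp: nth_eq_iff_index_eq)
    then show "a ! i \<noteq> a ! j" using d1 ij h(5) unfolding distinct_ints by simp
  qed
  have a1: "x \<in> set (ints \<rho>1)" if "x \<in> set (ints a)" for x
    using that[unfolded aps] h(4) unfolding mem_ints by auto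
  have "0 < x" if "x \<in> set (ints a)" for x
    using a1[OF that] h(1) by (simp add: star_string_def)
  then have sa: "star_string a" using da by (simp add: star_string_def)
  have "x \<in> set (ints b)" if xa: "x \<in> set (ints a)" and x2: "x \<in> set (ints \<rho>2)" for x
  proof (rule ccontr)
    assume "x \<notin> set (ints b)"
    then obtain i where i: "i < length \<rho>1" "i \<notin> set ps" "\<rho>1 ! i = Some x"
      using r2[OF x2] by blast
    obtain p where p: "p \<in> set ps" "\<rho>1 ! p = Some x" using xa aps by blast
    then have "p < length \<rho>1" "i \<noteq> p" using h(4) i(2) by auto
    then show False using d1 i p unfolding distinct_ints by (metis option.distinct(1))
  qed
  then have ab: "set (ints a) \<inter> set (ints \<rho>2) \<subseteq> set (ints b)" by auto
  have "\<forall>i<length \<beta>. \<forall>j<length \<alpha>. \<beta> ! i = \<alpha> ! j \<and> \<beta> ! i \<noteq> None \<longrightarrow> b ! i = a ! j"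
    using h(10) by metis
  moreover have "set ps \<subseteq> {..<length \<rho>2}" "length \<rho>1 = length \<rho>2" "b = map ((!) \<rho>2) ps"
      "map ((!) \<rho>1) ps = a"
    using h(4,5,11,12) by simp_all
  moreover have "\<forall>i<length \<rho>2. i \<notin> set ps \<longrightarrow> \<rho>1 ! i = \<rho>2 ! i"
    using h(11,13) by simp
  ultimately show ?thesis
    unfolding replacement_def
    apply (intro conjI P)
    apply (rule exI[of _ \<rho>2], rule exI[of _ \<rho>1], rule exI[of _ ps], rule exI[of _ b], rule exI[of _ a])
    using s2 sa ab h(2,3,6,8,14) by (intro conjI)
qed

lemma equiv_equiv_rel: "equiv perms (equiv_rel \<alpha> \<beta>)"
proof (rule equivI)
  let ?step = "\<lambda>x y. replacement \<alpha> \<beta> x y \<or> replacement \<beta> \<alpha> x y"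
  have "symp ?step"
  proof (rule sympI)
    fix x y assume "?step x y"
    then show "?step y x"
      using replacement_sym[of \<alpha> \<beta> x y] replacement_sym[of \<beta> \<alpha> x y] by argo
  qed
  then have "symp ?step\<^sup>*\<^sup>*" by (rule symp_rtranclp)
  then show "sym (equiv_rel \<alpha> \<beta>)"
    unfolding equiv_rel_def by (simp add: sym_def symp_def)
  show "trans (equiv_rel \<alpha> \<beta>)"
  proof (rule transI)
    fix x y z assume "(x, y) \<in> equiv_rel \<alpha> \<beta>" "(y, z) \<in> equiv_rel \<alpha> \<beta>"
    then show "(x, z) \<in> equiv_rel \<alpha> \<beta>"
      using rtranclp_trans[of ?step x y z] by (simp add: equiv_rel_def)
  qed
qed (auto simp: equiv_rel_def refl_on_def)

end

theory Submission imports Defs begin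

text \<open>Each of the three patterns \<open>\<beta>\<close> is \<open>123\<close> with one letter, at index \<open>k\<close>, overwritten by \<open>*\<close>.
  So a replacement \<open>123 \<rightarrow> \<beta>\<close> deletes the \<open>k\<close>-th entry of some copy of \<open>123\<close>, and
  \<open>\<beta> \<rightarrow> 123\<close> undoes such a deletion. Call an entry redundant if it is the \<open>k\<close>-th entry of some
  copy of \<open>123\<close>; the entries that may be deleted are exactly the redundant ones.

  The crucial fact (\<open>redundant_removeAll\<close>) is that deleting a redundant entry \<open>x\<close> does not
  change which of the other entries are redundant: if a copy of \<open>123\<close> shows that \<open>y\<close> is redundant and
  uses \<open>x\<close>, then the copy that makes \<open>x\<close> redundant supplies a substitute for \<open>x\<close>, because
  ``to the left of and smaller than'' is transitive. Therefore the subsequence of all entries that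
  are not redundant, renumbered to a permutation, is an invariant of the equivalence; call it the
  normal form. Conversely, deleting redundant entries one at a time leads from \<open>\<pi>\<close> to its normal
  form. So two permutations are equivalent iff they have the same normal form (\<open>equiv_rel_iff\<close>).
  As the normal form is a renumbered subsequence, it is the only shortest member of its class, that
  is, the primitive permutation (\<open>is_primitive_iff\<close>). A permutation that avoids \<open>123\<close> has no
  redundant entry and is its own normal form, so it is the primitive permutation of its own class
  and of no other.\<close>

section \<open>Renumbering\<close>

text \<open>An entry is replaced by its rank. Ranks count positions, so the definition refers to the list
  only through comparisons of its entries, and order-isomorphic lists get the same result at once.\<close>

definition standardize :: "nat list \<Rightarrow> nat list" where
  "standardize xs = map (\<lambda>i. card {j. j < length xs \<and> xs ! j \<le> xs ! i}) [0..<length xs]"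

lemma length_standardize [simp]: "length (standardize xs) = length xs"
  by (simp add: standardize_def)

lemma order_iso_imp_standardize_eq:
  assumes "order_iso xs ys"
  shows "standardize xs = standardize ys"
proof -
  have "{j. j < length xs \<and> xs ! j \<le> xs ! i} = {j. j < length ys \<and> ys ! j \<le> ys ! i}"
    if "i < length xs" for i
    using assms that by (auto simp: order_iso_def simp flip: not_less)
  then show ?thesis
    using assms by (simp add: standardize_def order_iso_def)
qed

lemma order_iso_standardize: "order_iso xs (standardize xs)"
proof -
  let ?L = "\<lambda>i. {j. j < length xs \<and> xs ! j \<le> xs ! i}"
  have "card (?L i) < card (?L j)" if "i < length xs" "j < length xs" "xs ! i < xs ! j" for i j
  proof (rule psubset_card_mono)
    have "j \<in> ?L j" "j \<notin> ?L i" using that by simp_all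
    moreover have "?L i \<subseteq> ?L j" using that(3) by auto
    ultimately show "?L i \<subset> ?L j" by blast
  qed simp
  moreover have "card (?L i) \<le> card (?L j)" if "xs ! i \<le> xs ! j" for i j
    using that by (intro card_mono) auto
  ultimately have "xs ! i < xs ! j \<longleftrightarrow> card (?L i) < card (?L j)"
    if "i < length xs" "j < length xs" for i j
    using that by (meson not_less)
  then show ?thesis by (simp add: order_iso_def standardize_def)
qed

lemma order_iso_distinct:
  assumes "order_iso xs ys" "distinct xs"
  shows "distinct ys"
  using assms unfolding order_iso_def distinct_conv_nth by (metis less_irrefl linorder_neqE_nat)

lemma standardize_in_perms:
  assumes "distinct xs"
  shows "standardize xs \<in> perms"
proof -
  let ?n = "length xs"
  have d: "distinct (standardize xs)"
    using order_iso_distinct[OF order_iso_standardize assms] .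
  have "standardize xs ! i \<in> {1..?n}" if "i < ?n" for i
  proof -
    let ?L = "{j. j < ?n \<and> xs ! j \<le> xs ! i}"
    have "card ?L \<le> card {..<?n}" by (intro card_mono) auto
    moreover have "card ?L \<noteq> 0" using that by auto
    ultimately have "card ?L \<in> {1..?n}" unfolding atLeastAtMost_iff card_lessThan by linarith
    then show ?thesis using that by (simp add: standardize_def)
  qed
  then have "set (standardize xs) \<subseteq> {1..?n}"
    by (metis in_set_conv_nth length_standardize subsetI)
  moreover have "card (set (standardize xs)) = card {1..?n}"
    using d by (simp add: distinct_card)
  ultimately have "set (standardize xs) = {1..?n}"
    by (intro card_subset_eq) auto
  then show ?thesis
    using d unfolding perms_def permutations_of_set_def by blast
qed

lemma standardize_perm:
  assumes "\<pi> \<in> perms"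
  shows "standardize \<pi> = \<pi>"
proof (rule nth_equalityI)
  fix i assume "i < length (standardize \<pi>)"
  then have i: "i < length \<pi>" by simp
  obtain n where n: "set \<pi> = {1..n}" "distinct \<pi>"
    using assms by (auto simp: perms_def permutations_of_set_def)
  let ?L = "{j. j < length \<pi> \<and> \<pi> ! j \<le> \<pi> ! i}"
  have "\<pi> ! i \<le> n" using i n nth_mem[OF i] by auto
  have "inj_on ((!) \<pi>) ?L"
    using n(2) by (auto simp: inj_on_def nth_eq_iff_index_eq)
  moreover have "(!) \<pi> ` ?L = {v \<in> set \<pi>. v \<le> \<pi> ! i}"
    by (auto simp: in_set_conv_nth)
  moreover have "{v \<in> set \<pi>. v \<le> \<pi> ! i} = {1..\<pi> ! i}"
    using n(1) \<open>\<pi> ! i \<le> n\<close> by auto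
  ultimately have "card ?L = \<pi> ! i"
    using card_image[of "(!) \<pi>" ?L] by simp
  then show "standardize \<pi> ! i = \<pi> ! i"
    using i by (simp add: standardize_def)
qed simp

text \<open>On lists of distinct numbers, an order isomorphism is a strictly monotone relabelling. This
  form lets subsequences be carried along it.\<close>

lemma order_iso_map:
  assumes "\<And>x y. x \<in> set xs \<Longrightarrow> y \<in> set xs \<Longrightarrow> f x < f y \<longleftrightarrow> x < y"
  shows "order_iso xs (map f xs)"
  using assms by (auto simp: order_iso_def)

lemma order_iso_obtain_map:
  fixes xs ys :: "nat list"
  assumes "order_iso xs ys" "distinct xs"
  obtains f where "ys = map f xs"
    "\<And>x y. x \<in> set xs \<Longrightarrow> y \<in> set xs \<Longrightarrow> f x < f y \<longleftrightarrow> x < y"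
proof -
  define f where "f = (\<lambda>x. the (map_of (zip xs ys) x))"
  have len: "length xs = length ys" using assms(1) by (simp add: order_iso_def)
  have f: "f (xs ! i) = ys ! i" if "i < length xs" for i
    using that assms(2) len by (simp add: f_def map_of_zip_nth)
  show thesis
  proof
    show "ys = map f xs" using f len by (intro nth_equalityI) auto
    show "f x < f y \<longleftrightarrow> x < y" if "x \<in> set xs" "y \<in> set xs" for x y
      using that f assms(1) unfolding order_iso_def by (metis in_set_conv_nth)
  qed
qed

section \<open>Redundant entries\<close>

text \<open>In a list of distinct numbers this relation is a strict partial order on the entries, and the
  copies of \<open>123\<close> are its chains of three.\<close>

definition prec :: "nat list \<Rightarrow> nat \<Rightarrow> nat \<Rightarrow> bool" where
  "prec xs a b \<longleftrightarrow> a < b \<and> subseq [a, b] xs"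

definition redundant :: "nat \<Rightarrow> nat list \<Rightarrow> nat \<Rightarrow> bool" where
  "redundant k xs x \<longleftrightarrow> (\<exists>a b c. prec xs a b \<and> prec xs b c \<and> x = [a, b, c] ! k)"

definition core :: "nat \<Rightarrow> nat list \<Rightarrow> nat list" where
  "core k xs = filter (\<lambda>x. \<not> redundant k xs x) xs"

lemma subseq_pair_iff_nth:
  "subseq [a, b] xs \<longleftrightarrow> (\<exists>p q. p < q \<and> q < length xs \<and> xs ! p = a \<and> xs ! q = b)"
proof (induction xs)
  case (Cons x xs)
  have "(\<exists>p q. p < q \<and> q < length (x # xs) \<and> (x # xs) ! p = a \<and> (x # xs) ! q = b) \<longleftrightarrow>
    (x = a \<and> b \<in> set xs) \<or> (\<exists>p q. p < q \<and> q < length xs \<and> xs ! p = a \<and> xs ! q = b)"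
    (is "?l \<longleftrightarrow> ?r")
  proof
    assume ?l
    then obtain p q where "p < q" "q < length (x # xs)" "(x # xs) ! p = a" "(x # xs) ! q = b"
      by blast
    then show ?r by (cases p; cases q) auto
  next
    assume ?r
    then show ?l
    proof (elim disjE conjE exE)
      assume "x = a" "b \<in> set xs"
      then obtain q where "q < length xs" "xs ! q = b" by (auto simp: in_set_conv_nth)
      with \<open>x = a\<close> show ?l by (intro exI[of _ 0] exI[of _ "Suc q"]) simp
    next
      fix p q assume "p < q" "q < length xs" "xs ! p = a" "xs ! q = b"
      then show ?l by (intro exI[of _ "Suc p"] exI[of _ "Suc q"]) simp
    qed
  qed
  moreover have "b \<in> set xs" if "subseq [a, b] xs"
    using that by (auto dest: list_emb_set)
  ultimately show ?case
    using Cons by (auto simp: subseq_singleton_left)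
qed simp

text \<open>Distinctness makes the two occurrences of \<open>b\<close> one and the same, so that the pairs can be
  glued.\<close>

lemma subseq_triple:
  assumes "distinct xs" "subseq [a, b] xs" "subseq [b, c] xs"
  shows "subseq [a, b, c] xs"
  using assms
proof (induction xs)
  case (Cons x xs)
  then show ?case
    by (auto simp: subseq_singleton_left split: if_splits dest: list_emb_set)
qed simp

lemma subseq_pair_filter:
  "subseq [a, b] (filter P xs) \<longleftrightarrow> subseq [a, b] xs \<and> P a \<and> P b"
  by (induction xs) (auto simp: subseq_singleton_left split: if_splits dest: list_emb_set)

lemma subseq_pair_map:
  assumes "inj_on f (set xs)" "a \<in> set xs" "b \<in> set xs"
  shows "subseq [f a, f b] (map f xs) \<longleftrightarrow> subseq [a, b] xs"
proof -
  have "map f xs ! p = f y \<longleftrightarrow> xs ! p = y" if "p < length xs" "y \<in> set xs" for p y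
    using assms(1) that by (simp add: inj_on_eq_iff)
  then have "p < q \<and> q < length xs \<and> map f xs ! p = f a \<and> map f xs ! q = f b \<longleftrightarrow>
      p < q \<and> q < length xs \<and> xs ! p = a \<and> xs ! q = b" for p q
    using assms(2,3) less_trans by blast
  then show ?thesis by (simp add: subseq_pair_iff_nth)
qed

lemma prec_trans:
  assumes "distinct xs" "prec xs a b" "prec xs b c"
  shows "prec xs a c"
proof -
  have "subseq [a, b, c] xs"
    using assms subseq_triple[OF assms(1)] by (simp add: prec_def)
  moreover have "subseq [a, c] [a, b, c]" by simp
  ultimately show ?thesis
    using assms subseq_order.trans[of "[a, c]" "[a, b, c]" xs] by (simp add: prec_def)
qed

lemma prec_irrefl: "\<not> prec xs a a"
  by (simp add: prec_def)

lemma prec_in_set: "prec xs a b \<Longrightarrow> a \<in> set xs \<and> b \<in> set xs"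
  unfolding prec_def subseq_pair_iff_nth using less_trans nth_mem by metis

lemma redundant_in_set: "redundant k xs x \<Longrightarrow> k < 3 \<Longrightarrow> x \<in> set xs"
  using prec_in_set unfolding redundant_def by (fastforce simp: less_Suc_eq numeral_3_eq_3)

lemma prec_removeAll: "prec (removeAll x xs) a b \<longleftrightarrow> prec xs a b \<and> a \<noteq> x \<and> b \<noteq> x"
  by (auto simp: prec_def removeAll_filter_not_eq subseq_pair_filter)

text \<open>Everything is read in the order \<^const>\<open>prec\<close>. In a chain that makes \<open>y\<close> redundant and contains \<open>x\<close>, replace \<open>x\<close> by a member of a chain that
  makes \<open>x\<close> redundant: for \<open>k = 0\<close> the part of the chain after \<open>y\<close> is replaced by the two elements
  above \<open>x\<close>, for \<open>k = 2\<close> the part before \<open>y\<close> by the two elements below \<open>x\<close>, and for \<open>k = 1\<close> the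
  element \<open>x\<close> by the one below it or the one above it.\<close>

lemma redundant_removeAll:
  assumes "distinct xs" "k < 3" "redundant k xs x" "y \<noteq> x"
  shows "redundant k (removeAll x xs) y \<longleftrightarrow> redundant k xs y"
proof
  assume "redundant k (removeAll x xs) y"
  then show "redundant k xs y" unfolding redundant_def prec_removeAll by blast
next
  note tr = prec_trans[OF assms(1)] and irr = prec_irrefl[of xs]
  assume y: "redundant k xs y"
  consider "k = 0" | "k = 1" | "k = 2" using assms(2) by linarith
  then show "redundant k (removeAll x xs) y"
  proof cases
    case 1
    then obtain b c where "prec xs x b" "prec xs b c"
      using assms(3) by (auto simp: redundant_def)
    moreover obtain v w where "prec xs y v" "prec xs v w"
      using y 1 by (auto simp: redundant_def)
    ultimately have "\<exists>v w. prec (removeAll x xs) y v \<and> prec (removeAll x xs) v w"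
      unfolding prec_removeAll using tr irr assms(4) by metis
    then show ?thesis using 1 by (auto simp: redundant_def)
  next
    case 2
    then obtain a c where "prec xs a x" "prec xs x c"
      using assms(3) by (auto simp: redundant_def)
    moreover obtain u w where "prec xs u y" "prec xs y w"
      using y 2 by (auto simp: redundant_def)
    ultimately have "\<exists>u w. prec (removeAll x xs) u y \<and> prec (removeAll x xs) y w"
      unfolding prec_removeAll using tr irr assms(4) by metis
    then show ?thesis using 2 by (auto simp: redundant_def)
  next
    case 3
    then obtain a b where "prec xs a b" "prec xs b x"
      using assms(3) by (auto simp: redundant_def)
    moreover obtain u v where "prec xs u v" "prec xs v y"
      using y 3 by (auto simp: redundant_def)
    ultimately have "\<exists>u v. prec (removeAll x xs) u v \<and> prec (removeAll x xs) v y"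
      unfolding prec_removeAll using tr irr assms(4) by metis
    then show ?thesis using 3 by (auto simp: redundant_def)
  qed
qed

lemma core_removeAll:
  assumes "distinct xs" "k < 3" "redundant k xs x"
  shows "core k (removeAll x xs) = core k xs"
  unfolding core_def removeAll_filter_not_eq filter_filter
  unfolding removeAll_filter_not_eq[symmetric]
  using assms(3) redundant_removeAll[OF assms] by (intro filter_cong refl) metis

lemma core_eq_self_iff:
  assumes "k < 3"
  shows "core k xs = xs \<longleftrightarrow> (\<forall>x. \<not> redundant k xs x)"
  unfolding core_def filter_id_conv using redundant_in_set[OF _ assms] by blast

lemma prec_map:
  assumes "\<And>x y. x \<in> set xs \<Longrightarrow> y \<in> set xs \<Longrightarrow> f x < f y \<longleftrightarrow> x < y"
    and "a \<in> set xs" "b \<in> set xs"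
  shows "prec (map f xs) (f a) (f b) \<longleftrightarrow> prec xs a b"
proof -
  have "inj_on f (set xs)"
    using assms(1) by (intro inj_onI) (metis less_irrefl linorder_neqE_nat)
  from subseq_pair_map[OF this assms(2,3)] show ?thesis
    by (simp only: prec_def assms(1)[OF assms(2,3)])
qed

lemma redundant_map:
  assumes mono: "\<And>x y. x \<in> set xs \<Longrightarrow> y \<in> set xs \<Longrightarrow> f x < f y \<longleftrightarrow> x < y"
    and "k < 3" "x \<in> set xs"
  shows "redundant k (map f xs) (f x) \<longleftrightarrow> redundant k xs x"
proof
  have nth_map3: "[f a, f b, f c] ! k = f ([a, b, c] ! k)" for a b c
    using nth_map[of k "[a, b, c]" f] \<open>k < 3\<close> by simp
  note pm = prec_map[of xs f, OF mono]
  show "redundant k (map f xs) (f x)" if "redundant k xs x"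
  proof -
    from that obtain a b c where abc: "prec xs a b" "prec xs b c" "x = [a, b, c] ! k"
      by (auto simp: redundant_def)
    then have "prec (map f xs) (f a) (f b)" "prec (map f xs) (f b) (f c)"
      using pm by (auto dest: prec_in_set)
    then show ?thesis unfolding redundant_def using abc(3) nth_map3 by metis
  qed
  show "redundant k xs x" if "redundant k (map f xs) (f x)"
  proof -
    from that obtain u v w where
      uvw: "prec (map f xs) u v" "prec (map f xs) v w" "f x = [u, v, w] ! k"
      by (auto simp: redundant_def)
    then obtain a b c where abc: "a \<in> set xs" "b \<in> set xs" "c \<in> set xs"
      "u = f a" "v = f b" "w = f c"
      by (auto dest!: prec_in_set)
    then have "f x = f ([a, b, c] ! k)" using uvw(3) nth_map3 by simp
    moreover have "[a, b, c] ! k \<in> set xs"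
      using abc \<open>k < 3\<close> nth_mem[of k "[a, b, c]"] by auto
    ultimately have "x = [a, b, c] ! k"
      using mono \<open>x \<in> set xs\<close> by (metis less_irrefl linorder_neqE_nat)
    moreover have "prec xs a b" "prec xs b c" using uvw abc pm by auto
    ultimately show ?thesis by (auto simp: redundant_def)
  qed
qed

definition normal_form :: "nat \<Rightarrow> nat list \<Rightarrow> nat list" where
  "normal_form k xs = standardize (core k xs)"

lemma normal_form_order_iso:
  assumes "order_iso xs ys" "distinct xs" "k < 3"
  shows "normal_form k xs = normal_form k ys"
proof -
  obtain f where ys: "ys = map f xs"
    and mono: "\<And>x y. x \<in> set xs \<Longrightarrow> y \<in> set xs \<Longrightarrow> f x < f y \<longleftrightarrow> x < y"
    using order_iso_obtain_map[OF assms(1,2)] by blast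
  have "core k ys = map f (core k xs)"
    unfolding ys core_def filter_map
    using redundant_map[of xs f, OF mono assms(3)] by (simp cong: filter_cong)
  moreover have "order_iso (core k xs) (map f (core k xs))"
    by (rule order_iso_map) (auto simp: core_def mono)
  ultimately show ?thesis
    by (simp add: normal_form_def order_iso_imp_standardize_eq)
qed

section \<open>Replacement as deletion of a redundant entry\<close>

lemma ints_append: "ints (s @ t) = ints s @ ints t"
  by (simp add: ints_def map_filter_def)

lemma ints_Cons: "ints (c # s) = (case c of None \<Rightarrow> ints s | Some x \<Rightarrow> x # ints s)"
  by (simp add: ints_def split: option.split)

lemma ints_Nil: "ints [] = []"
  by (simp add: ints_def)

lemma ints_map_Some: "ints (map Some xs) = xs"
  by (induction xs) (simp_all add: ints_Cons ints_Nil)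

lemma subseq_ints: "subseq s t \<Longrightarrow> subseq (ints s) (ints t)"
  unfolding ints_def map_filter_def by (intro subseq_map subseq_filter)

lemma ints_list_update_None:
  assumes "distinct (ints s)" "i < length s" "s ! i = Some x"
  shows "ints (s[i := None]) = removeAll x (ints s)"
proof -
  have "ints s = ints (take i s) @ x # ints (drop (Suc i) s)"
    by (subst id_take_nth_drop[OF assms(2)]) (simp add: ints_append ints_Cons assms(3))
  moreover have "ints (s[i := None]) = ints (take i s) @ ints (drop (Suc i) s)"
    by (simp add: upd_conv_take_nth_drop[OF assms(2)] ints_append ints_Cons)
  ultimately show ?thesis
    using assms(1) by simp
qed

lemma is_copy_p123:
  "is_copy s p123 \<longleftrightarrow> (\<exists>a b c. s = [Some a, Some b, Some c] \<and> a < b \<and> b < c)"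
proof
  assume s: "is_copy s p123"
  then have "length s = 3" by (simp add: is_copy_def p123_def)
  then obtain x y z where xyz: "s = [x, y, z]"
    by (auto simp: numeral_3_eq_3 length_Suc_conv)
  have "x \<noteq> None" "y \<noteq> None" "z \<noteq> None"
    using s unfolding xyz is_copy_def p123_def by (auto simp: All_less_Suc2)
  then obtain a b c where abc: "x = Some a" "y = Some b" "z = Some c" by blast
  have "a < b \<and> b < c"
    using s unfolding xyz abc is_copy_def p123_def order_iso_def
    by (simp add: ints_Cons ints_Nil All_less_Suc2)
  then show "\<exists>a b c. s = [Some a, Some b, Some c] \<and> a < b \<and> b < c"
    using xyz abc by blast
next
  assume "\<exists>a b c. s = [Some a, Some b, Some c] \<and> a < b \<and> b < c"
  then show "is_copy s p123"
    by (elim exE conjE)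
      (simp add: is_copy_def p123_def order_iso_def ints_Cons ints_Nil All_less_Suc2)
qed

text \<open>The letters common to \<open>123\<close> and \<open>\<beta>\<close> must be kept, at their positions, when \<open>b\<close> is written over
  \<open>a\<close>. So the two strings of integers and \<open>*\<close>'s differ only at the \<open>k\<close>-th position of \<open>a\<close>, where
  an integer becomes \<open>*\<close>. The list \<open>xs\<close> consists of the integers before this change; its labels
  may differ from those of \<open>\<pi>\<close>, which is why \<open>\<pi>\<close> and \<open>\<sigma>\<close> are described only up to
  order isomorphism.\<close>

lemma replacement_imp_deletion:
  assumes "replacement p123 (p123[k := None]) \<pi> \<sigma>" "k < 3"
  obtains xs x where "distinct xs" "redundant k xs x"
    "order_iso xs \<pi>" "order_iso (removeAll x xs) \<sigma>"
proof -
  let ?\<beta> = "p123[k := None]"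
  obtain r1 r2 ps a b where h: "star_string r1" "order_iso (ints r1) \<pi>"
      "sorted_wrt (<) ps" "set ps \<subseteq> {..<length r1}" "a = map ((!) r1) ps" "is_copy a p123"
      "is_copy b ?\<beta>"
      "\<forall>i<length p123. \<forall>j<length ?\<beta>. p123 ! i = ?\<beta> ! j \<and> p123 ! i \<noteq> None \<longrightarrow> a ! i = b ! j"
      "length r2 = length r1" "map ((!) r2) ps = b"
      "\<forall>i<length r1. i \<notin> set ps \<longrightarrow> r2 ! i = r1 ! i"
      "order_iso (ints r2) \<sigma>"
    using assms(1) unfolding replacement_def by (elim conjE exE) (rule that)
  obtain u v w where uvw: "a = [Some u, Some v, Some w]" "u < v" "v < w"
    using h(6) is_copy_p123 by blast
  have "length ps = 3" using uvw(1) h(5) by (metis length_map length_Cons list.size(3) numeral_3_eq_3)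
  then obtain p q r where ps: "ps = [p, q, r]"
    by (auto simp: numeral_3_eq_3 length_Suc_conv)
  have pqr: "p < q" "q < r" "r < length r1" "r1 ! p = Some u" "r1 ! q = Some v" "r1 ! r = Some w"
    using h(3,4,5) uvw(1) ps by auto
  have d: "distinct (ints r1)" using h(1) by (simp add: star_string_def)
  let ?x = "[u, v, w] ! k"
  have len: "length p123 = 3" by (simp add: p123_def)
  have bk: "b ! k = None"
    using h(7) assms(2) unfolding is_copy_def by (simp add: len)
  have bi: "b ! i = a ! i" if "i < 3" "i \<noteq> k" for i
  proof -
    have "p123 ! i \<noteq> None" using that(1) by (auto simp: p123_def less_Suc_eq numeral_3_eq_3)
    then show ?thesis using h(8) that by (simp add: len)
  qed
  have k: "ps ! k < length r1" "r1 ! (ps ! k) = Some ?x"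
    using assms(2) pqr ps by (auto simp: less_Suc_eq numeral_3_eq_3)
  have "r2 = r1[ps ! k := None]"
  proof (rule nth_equalityI)
    show "length r2 = length (r1[ps ! k := None])" using h(9) by simp
    fix i assume "i < length r2"
    then have i: "i < length r1" using h(9) by simp
    show "r2 ! i = r1[ps ! k := None] ! i"
    proof (cases "i \<in> set ps")
      case True
      then obtain m where m: "m < 3" "i = ps ! m"
        using \<open>length ps = 3\<close> by (metis in_set_conv_nth)
      have "r2 ! i = b ! m" "r1 ! i = a ! m"
        using m \<open>length ps = 3\<close> h(5,10) by (metis nth_map)+
      moreover have "distinct ps" using h(3) by (simp add: strict_sorted_iff)
      then have "i = ps ! k \<longleftrightarrow> m = k"
        using m assms(2) \<open>length ps = 3\<close> by (simp add: nth_eq_iff_index_eq)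
      ultimately show ?thesis
        using bk bi m(1) i by (cases "m = k") auto
    next
      case False
      then have "i \<noteq> ps ! k" using assms(2) \<open>length ps = 3\<close> by auto
      then show ?thesis using h(11) i False by simp
    qed
  qed
  then have "ints r2 = removeAll ?x (ints r1)"
    using ints_list_update_None[OF d k] by simp
  moreover have "redundant k (ints r1) ?x"
  proof -
    have "subseq [Some u, Some v] r1" "subseq [Some v, Some w] r1"
      unfolding subseq_pair_iff_nth using pqr less_trans by blast+
    then have "prec (ints r1) u v" "prec (ints r1) v w"
      using uvw(2,3) by (auto simp: prec_def ints_Cons ints_Nil dest!: subseq_ints)
    then show ?thesis by (auto simp: redundant_def)
  qed
  ultimately show thesis using that d h(2,12) by metis
qed

text \<open>A replacement that performs a given deletion: keep the labels of \<open>\<pi>\<close>, insert no \<open>*\<close>, and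
  overwrite \<open>x\<close> by \<open>*\<close>.\<close>

lemma deletion_imp_replacement:
  assumes \<pi>: "\<pi> \<in> perms" and "redundant k \<pi> x" "k < 3"
  shows "replacement p123 (p123[k := None]) \<pi> (standardize (removeAll x \<pi>))"
proof -
  have d: "distinct \<pi>" using \<pi> by (rule perms_distinct)
  have pos: "\<forall>y\<in>set \<pi>. 0 < y"
    using \<pi> by (auto simp: perms_def permutations_of_set_def)
  obtain u v w where uvw: "prec \<pi> u v" "prec \<pi> v w" "x = [u, v, w] ! k"
    using assms(2) by (auto simp: redundant_def)
  then obtain p q q' r where "p < q" "q < length \<pi>" "\<pi> ! p = u" "\<pi> ! q = v"
    "q' < r" "r < length \<pi>" "\<pi> ! q' = v" "\<pi> ! r = w"
    unfolding prec_def subseq_pair_iff_nth by blast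
  \<comment> \<open>both pairs contain the entry \<open>v\<close>, which has only one position\<close>
  moreover from this have "q' = q" using d by (auto simp: nth_eq_iff_index_eq)
  ultimately have pqr: "p < q" "q < r" "r < length \<pi>" "\<pi> ! p = u" "\<pi> ! q = v" "\<pi> ! r = w"
    by auto
  have lt: "u < v" "v < w" using uvw by (auto simp: prec_def)
  define ps where "ps = [p, q, r]"
  define r1 where "r1 = map Some \<pi>"
  define r2 where "r2 = r1[ps ! k := None]"
  define a where "a = [Some u, Some v, Some w]"
  have k: "k = 0 \<or> k = 1 \<or> k = 2" using assms(3) by linarith
  have i1: "ints r1 = \<pi>" by (simp add: r1_def ints_map_Some)
  have "ps ! k < length r1" "r1 ! (ps ! k) = Some x"
    using k pqr uvw(3) by (auto simp: ps_def r1_def)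
  then have i2: "ints r2 = removeAll x \<pi>"
    unfolding r2_def using ints_list_update_None[of r1] i1 d by simp
  have a: "a = map ((!) r1) ps"
    using pqr by (simp add: a_def ps_def r1_def)
  have b: "map ((!) r2) ps = a[k := None]"
    using pqr k by (auto simp: r2_def a_def ps_def r1_def)
  have uvw_in: "u \<in> set \<pi>" "v \<in> set \<pi>" "w \<in> set \<pi>"
    using uvw by (auto dest: prec_in_set)
  have "star_string r1" using d pos i1 by (simp add: star_string_def)
  moreover have "order_iso (ints r1) \<pi>" by (simp add: i1 order_iso_def)
  moreover have "sorted_wrt (<) ps" "set ps \<subseteq> {..<length r1}"
    using pqr by (auto simp: ps_def r1_def)
  moreover have "is_copy a p123" using lt by (auto simp: is_copy_p123 a_def)
  moreover have "star_string (a[k := None])"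
    using k lt pos uvw_in by (auto simp: star_string_def a_def ints_Cons ints_Nil)
  moreover have "is_copy (a[k := None]) (p123[k := None])"
    using k lt by (elim disjE)
      (simp_all add: is_copy_def a_def p123_def order_iso_def ints_Cons ints_Nil All_less_Suc2)
  moreover have "set (ints (a[k := None])) \<inter> set (ints r1) \<subseteq> set (ints a)"
    using k by (auto simp: a_def ints_Cons ints_Nil)
  moreover have "\<forall>i<length p123. \<forall>j<length (p123[k := None]).
      p123 ! i = p123[k := None] ! j \<and> p123 ! i \<noteq> None \<longrightarrow> a ! i = a[k := None] ! j"
    using k by (elim disjE) (simp_all add: p123_def a_def All_less_Suc2)
  moreover have "length r2 = length r1" by (simp add: r2_def)
  moreover have "\<forall>i<length r1. i \<notin> set ps \<longrightarrow> r2 ! i = r1 ! i"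
    using k by (auto simp: r2_def ps_def)
  moreover have "order_iso (ints r2) (standardize (removeAll x \<pi>))"
    by (simp add: i2 order_iso_standardize)
  moreover have "standardize (removeAll x \<pi>) \<in> perms"
    using d by (intro standardize_in_perms) (simp add: distinct_removeAll)
  ultimately show ?thesis
    unfolding replacement_def using \<pi> a b by blast
qed

section \<open>Equivalence classes and primitive permutations\<close>

lemma normal_form_replacement:
  assumes "replacement p123 (p123[k := None]) \<pi> \<sigma>" "k < 3"
  shows "normal_form k \<pi> = normal_form k \<sigma>"
proof -
  obtain xs x where xs: "distinct xs" "redundant k xs x"
    "order_iso xs \<pi>" "order_iso (removeAll x xs) \<sigma>"
    using replacement_imp_deletion[OF assms] .
  have "normal_form k \<pi> = normal_form k xs"
    using normal_form_order_iso xs assms(2) by metis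
  also have "\<dots> = normal_form k (removeAll x xs)"
    using core_removeAll[OF xs(1) assms(2) xs(2)] by (simp add: normal_form_def)
  also have "\<dots> = normal_form k \<sigma>"
    using normal_form_order_iso xs assms(2) by (simp add: distinct_removeAll)
  finally show ?thesis .
qed

lemma normal_form_equiv_rel:
  assumes "(\<pi>, \<sigma>) \<in> equiv_rel p123 (p123[k := None])" "k < 3"
  shows "normal_form k \<pi> = normal_form k \<sigma>"
proof -
  let ?\<beta> = "p123[k := None]"
  have "(\<lambda>x y. replacement p123 ?\<beta> x y \<or> replacement ?\<beta> p123 x y)\<^sup>*\<^sup>* \<pi> \<sigma>"
    using assms(1) by (simp add: equiv_rel_def)
  then show ?thesis
  proof induction
    case (step y z)
    then show ?case
      using normal_form_replacement assms(2) replacement_sym by metis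
  qed simp
qed

lemma normal_form_eq_self:
  assumes "\<pi> \<in> perms" "k < 3" "\<And>x. \<not> redundant k \<pi> x"
  shows "normal_form k \<pi> = \<pi>"
proof -
  have "core k \<pi> = \<pi>" using assms(2,3) core_eq_self_iff by blast
  then show ?thesis using standardize_perm[OF assms(1)] by (simp add: normal_form_def)
qed

text \<open>Each deletion of a redundant entry is a replacement that shortens the permutation and keeps
  its normal form; the process stops when no entry is redundant, and then the permutation is equal
  to its normal form.\<close>

lemma equiv_rel_normal_form:
  assumes "\<pi> \<in> perms" "k < 3"
  shows "(\<pi>, normal_form k \<pi>) \<in> equiv_rel p123 (p123[k := None])"
  using assms(1)
proof (induction "length \<pi>" arbitrary: \<pi> rule: less_induct)
  case less
  let ?E = "equiv_rel p123 (p123[k := None])"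
  show ?case
  proof (cases "\<exists>x. redundant k \<pi> x")
    case True
    then obtain x where x: "redundant k \<pi> x" by blast
    define \<sigma> where "\<sigma> = standardize (removeAll x \<pi>)"
    have r: "replacement p123 (p123[k := None]) \<pi> \<sigma>"
      using deletion_imp_replacement[OF less.prems x assms(2)] by (simp add: \<sigma>_def)
    then have \<sigma>: "\<sigma> \<in> perms" by (simp add: replacement_def)
    have "length \<sigma> < length \<pi>"
      using redundant_in_set[OF x assms(2)] by (simp add: \<sigma>_def length_removeAll_less)
    then have "(\<sigma>, normal_form k \<sigma>) \<in> ?E" using less.hyps \<sigma> by blast
    moreover have "(\<pi>, \<sigma>) \<in> ?E"
      using r less.prems \<sigma> by (auto simp: equiv_rel_def)
    moreover have "trans ?E" using equiv_equiv_rel by (simp add: equiv_def)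
    ultimately show ?thesis
      using normal_form_replacement[OF r assms(2)] by (metis transD)
  next
    case False
    then show ?thesis
      using normal_form_eq_self[OF less.prems assms(2)] less.prems by (simp add: equiv_rel_def)
  qed
qed

lemma equiv_rel_iff:
  assumes "k < 3"
  shows "(\<pi>, \<sigma>) \<in> equiv_rel p123 (p123[k := None]) \<longleftrightarrow>
    \<pi> \<in> perms \<and> \<sigma> \<in> perms \<and> normal_form k \<pi> = normal_form k \<sigma>"
proof
  assume "(\<pi>, \<sigma>) \<in> equiv_rel p123 (p123[k := None])"
  then show "\<pi> \<in> perms \<and> \<sigma> \<in> perms \<and> normal_form k \<pi> = normal_form k \<sigma>"
    using normal_form_equiv_rel assms by (auto simp: equiv_rel_def)
next
  assume h: "\<pi> \<in> perms \<and> \<sigma> \<in> perms \<and> normal_form k \<pi> = normal_form k \<sigma>"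
  let ?E = "equiv_rel p123 (p123[k := None])"
  have "(\<pi>, normal_form k \<pi>) \<in> ?E" "(\<sigma>, normal_form k \<pi>) \<in> ?E"
    using h equiv_rel_normal_form assms by metis+
  then show "(\<pi>, \<sigma>) \<in> ?E"
    using equiv_equiv_rel[of p123 "p123[k := None]"] by (meson equivE symD transD)
qed

text \<open>Every member \<open>\<sigma>\<close> of the class of \<open>\<pi>\<close> is at least as long as the common normal form, and if it
  has the same length then nothing was removed from \<open>\<sigma>\<close>, so that \<open>\<sigma>\<close> is the normal form.\<close>

lemma is_primitive_iff:
  assumes "\<pi> \<in> perms" "k < 3"
  shows "is_primitive p123 (p123[k := None]) \<pi> \<tau> \<longleftrightarrow> \<tau> = normal_form k \<pi>"
proof -
  let ?P = "\<lambda>\<sigma>. (\<pi>, \<sigma>) \<in> equiv_rel p123 (p123[k := None])"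
  let ?n = "normal_form k \<pi>"
  have n: "?P ?n" using equiv_rel_normal_form[OF assms] .
  have le: "length ?n \<le> length \<sigma>" if "?P \<sigma>" for \<sigma>
    using that assms by (simp add: equiv_rel_iff normal_form_def core_def)
  have eq: "\<sigma> = ?n" if "?P \<sigma>" "length \<sigma> \<le> length ?n" for \<sigma>
  proof -
    have \<sigma>: "\<sigma> \<in> perms" "normal_form k \<sigma> = ?n"
      using that(1) assms(2) by (auto simp: equiv_rel_iff)
    then have "\<not> length (core k \<sigma>) < length \<sigma>"
      using that(2) by (metis length_standardize normal_form_def not_less)
    then have "core k \<sigma> = \<sigma>"
      unfolding core_def by (meson filter_id_conv length_filter_less)
    then show ?thesis
      using \<sigma> standardize_perm by (simp add: normal_form_def)
  qed
  have "is_arg_min length ?P \<sigma> \<longleftrightarrow> \<sigma> = ?n" for \<sigma>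
    unfolding is_arg_min_def using n le eq by (metis not_less)
  then show ?thesis unfolding is_primitive_def by blast
qed

lemma avoids_123_not_redundant:
  assumes "avoids_123 \<tau>" "distinct \<tau>"
  shows "\<not> redundant k \<tau> x"
proof
  assume "redundant k \<tau> x"
  then obtain a b c where "prec \<tau> a b" "prec \<tau> b c" by (auto simp: redundant_def)
  then have "subseq [a, b, c] \<tau>" "sorted_wrt (<) [a, b, c]"
    using subseq_triple[OF assms(2)] by (auto simp: prec_def)
  then show False
    using assms(1) unfolding avoids_123_def by (metis length_Cons list.size(3) numeral_3_eq_3)
qed

theorem theorem19:
  fixes \<beta> :: "nat option list"
  assumes "\<beta> \<in> {[Some 1, Some 2, None], [Some 1, None, Some 3], [None, Some 2, Some 3]}"
  shows "(\<forall>\<tau>\<in>perms. avoids_123 \<tau> \<longrightarrow>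
            primitive_class p123 \<beta> \<tau> \<in> perms // equiv_rel p123 \<beta>) \<and>
         inj_on (primitive_class p123 \<beta>) {\<tau> \<in> perms. avoids_123 \<tau>}"
proof -
  have "\<beta> \<in> {p123[2 := None], p123[1 := None], p123[0 := None]}"
    using assms by (simp add: p123_def)
  then have "\<exists>k\<in>{2, 1, 0}. \<beta> = p123[k := None]" by simp
  then obtain k where "k \<in> {2, 1, 0}" and \<beta>: "\<beta> = p123[k := None]" by (rule bexE)
  then have k: "k < 3" "\<beta> = p123[k := None]" by auto
  have nf: "normal_form k \<tau> = \<tau>" if "\<tau> \<in> perms" "avoids_123 \<tau>" for \<tau>
    using that k(1) by (intro normal_form_eq_self avoids_123_not_redundant perms_distinct)
  have pc: "primitive_class p123 \<beta> \<tau> = {\<pi> \<in> perms. normal_form k \<pi> = \<tau>}" for \<tau>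
    using is_primitive_iff[OF _ k(1)] by (auto simp: primitive_class_def k(2))
  show ?thesis
  proof (intro conjI ballI impI)
    fix \<tau> assume \<tau>: "\<tau> \<in> perms" "avoids_123 \<tau>"
    then have "primitive_class p123 \<beta> \<tau> = equiv_rel p123 \<beta> `` {\<tau>}"
      unfolding pc using nf[OF \<tau>] by (auto simp: k equiv_rel_iff)
    then show "primitive_class p123 \<beta> \<tau> \<in> perms // equiv_rel p123 \<beta>"
      using \<tau>(1) by (simp add: quotientI)
  next
    show "inj_on (primitive_class p123 \<beta>) {\<tau> \<in> perms. avoids_123 \<tau>}"
    proof (rule inj_onI)
      fix \<tau> \<tau>' assume \<tau>: "\<tau> \<in> {\<tau> \<in> perms. avoids_123 \<tau>}"
        and eq: "primitive_class p123 \<beta> \<tau> = primitive_class p123 \<beta> \<tau>'"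
      have "\<tau> \<in> primitive_class p123 \<beta> \<tau>" using \<tau> nf by (simp add: pc)
      then have "normal_form k \<tau> = \<tau>'" by (simp add: eq) (simp add: pc)
      then show "\<tau> = \<tau>'" using \<tau> nf by simp
    qed
  qed
qed

end
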